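(* Let $n,m\ge 1$ and let $F:D^n\to\mathbb{R}^m$ be a continuous map such that $F(x)\neq 0$ for every $x\in S^{n-1}$. Let $F_\mid:S^{n-1}\to\mathbb{R}^m\setminus\{0\}$, $F_\mid(x)=F(x)$, be the restriction. If $\mathrm{cat}(F_\mid)=2$, then the equation $F(x)=0$ has a solution $x\in D^n$.
   Context: $D^n\subset\mathbb{R}^n$ is the closed unit disk and $S^{n-1}=\partial D^n$ the unit sphere. A continuous map $f:X\to Y$ of topological spaces is null-homotopic if it is homotopic to a constant map $X\to Y$, $x\mapsto y_0$, for some $y_0\in Y$ (homotopies are free, without base points). The category $\mathrm{cat}(f)$ of a continuous map $f:X\to Y$ is the least positive integer $k$ such that there are open subsets $U_1,\dots,U_k$ of $X$ with $X=U_1\cup\cdots\cup U_k$ and each restriction $f_{|U_i}:U_i\to Y$ null-homotopic; $\mathrm{cat}(f)=\infty$ if no such integer exists. *)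

theory Defs
  imports "HOL-Analysis.Analysis" "HOL-Library.Extended_Nat"
begin

text \<open>Free homotopy to a constant map. Only the values of \<open>f\<close> on \<open>topspace X\<close> matter, so the
  restriction of a map to a subspace \<open>U\<close> is expressed by replacing \<open>X\<close> with \<open>subtopology X U\<close>.\<close>

definition nullhomotopic_map :: "'a topology \<Rightarrow> 'b topology \<Rightarrow> ('a \<Rightarrow> 'b) \<Rightarrow> bool" where
  "nullhomotopic_map X Y f \<longleftrightarrow>
     (\<exists>y0\<in>topspace Y. homotopic_with (\<lambda>_. True) X Y f (\<lambda>_. y0))"

definition nullhomotopic_open_cover ::
    "'a topology \<Rightarrow> 'b topology \<Rightarrow> ('a \<Rightarrow> 'b) \<Rightarrow> nat \<Rightarrow> (nat \<Rightarrow> 'a set) \<Rightarrow> bool" where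
  "nullhomotopic_open_cover X Y f k U \<longleftrightarrow>
     (\<forall>i\<in>{1..k}. openin X (U i)) \<and>
     topspace X = (\<Union>i\<in>{1..k}. U i) \<and>
     (\<forall>i\<in>{1..k}. nullhomotopic_map (subtopology X (U i)) Y f)"

text \<open>The least element of a nonempty set of positive integers; the infimum of the empty set in
  \<^typ>\<open>enat\<close> is \<open>\<infinity>\<close>.\<close>

definition map_category :: "'a topology \<Rightarrow> 'b topology \<Rightarrow> ('a \<Rightarrow> 'b) \<Rightarrow> enat" where
  "map_category X Y f = Inf {enat k |k. k \<ge> 1 \<and> (\<exists>U. nullhomotopic_open_cover X Y f k U)}"

end

(* If F has no zero on the ball, then H(t, x) = F((1 - t) x) contracts F restricted to the sphere
   inside the complement of 0, so this restriction has category 1. *)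
theory Submission
  imports Defs
begin

text \<open>Argue by contraposition. A zero-free \<open>F\<close> extends its restriction to the
  sphere over the contractible ball with values still avoiding 0, so
  \<open>nullhomotopic_map_sphere_if_extends\<close> makes this restriction null-homotopic. By
  \<open>map_category_le_1\<close> its category is then at most 1, which excludes the value
  2.\<close>

lemma nullhomotopic_map_sphere_if_extends:
  fixes F :: "'a::real_normed_vector \<Rightarrow> 'b::topological_space"
  assumes cont: "continuous_on (cball 0 1) F" and im: "F ` cball 0 1 \<subseteq> S"
  shows "nullhomotopic_map (top_of_set (sphere 0 1)) (top_of_set S) F"
proof -
  \<comment> \<open>Radial shrinking: time 0 gives the point of the sphere, time 1 the centre. In
    between the norm is \<open>1 - fst p\<close>, so the path stays where \<open>F\<close> is
    controlled.\<close>
  have sub: "(\<lambda>p::real \<times> 'a. (1 - fst p) *\<^sub>R snd p) ` ({0..1} \<times> sphere 0 1) \<subseteq> cball 0 1"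
    by auto
  have "continuous_on ({0..1} \<times> sphere 0 1) (F \<circ> (\<lambda>p. (1 - fst p) *\<^sub>R snd p))"
    by (intro continuous_on_compose continuous_intros continuous_on_subset[OF cont] sub)
  moreover have "(F \<circ> (\<lambda>p. (1 - fst p) *\<^sub>R snd p)) ` ({0..1} \<times> sphere 0 1) \<subseteq> S"
    unfolding image_comp[symmetric] using im sub by blast
  ultimately have "homotopic_with_canon (\<lambda>_. True) (sphere 0 1) S F (\<lambda>_. F 0)"
    unfolding homotopic_with_def
    by (intro exI[of _ "F \<circ> (\<lambda>p. (1 - fst p) *\<^sub>R snd p)"])
       \<comment> \<open>The product of the two subspace topologies is the Euclidean one on the
         product set, which turns the homotopy condition into the two facts above.\<close>
       (simp add: prod_topology_subtopology_eu image_subset_iff_funcset o_def)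
  moreover have "F 0 \<in> S"
    using im by auto
  ultimately show ?thesis
    by (auto simp: nullhomotopic_map_def)
qed

text \<open>The whole space is an open cover with a single member, so 1 belongs to the set whose
  infimum is the category.\<close>

lemma map_category_le_1:
  assumes "nullhomotopic_map X Y f"
  shows "map_category X Y f \<le> 1"
proof -
  have "nullhomotopic_open_cover X Y f 1 (\<lambda>_. topspace X)"
    using assms by (simp add: nullhomotopic_open_cover_def)
  then show ?thesis
    unfolding map_category_def one_enat_def by (intro Inf_lower) blast
qed

theorem mainTheorem2:
  fixes F :: "real ^ 'n \<Rightarrow> real ^ 'm"
  assumes "continuous_on (cball 0 1) F"
    and "\<forall>x\<in>sphere 0 1. F x \<noteq> 0"
    and "map_category (top_of_set (sphere 0 1)) (top_of_set (UNIV - {0})) F = 2"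
  shows "\<exists>x\<in>cball 0 1. F x = 0"
proof (rule ccontr)
  assume "\<not> (\<exists>x\<in>cball 0 1. F x = 0)"
  then have "F ` cball 0 1 \<subseteq> UNIV - {0}"
    by auto
  with assms(1) have "map_category (top_of_set (sphere 0 1)) (top_of_set (UNIV - {0})) F \<le> 1"
    by (intro map_category_le_1 nullhomotopic_map_sphere_if_extends)
  with assms(3) show False
    by simp
qed

end
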